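(* Let $\delta\in\mathbb{C}$ and let $\mathcal{V}ar_\delta$ be the variety of $\delta$-Novikov algebras over $\mathbb{C}$. Then $\mathcal{V}ar_\delta$ does not satisfy the Nielsen--Schreier property.
   Context: A (left) $\delta$-Novikov algebra is a (not necessarily associative) algebra satisfying, for all $x,y,z$, $\delta(xy)z-x(yz)=\delta(yx)z-y(xz)$ and $(xy)z=(xz)y$. A variety of algebras satisfies the Nielsen--Schreier property if every subalgebra of a free algebra of the variety is itself a free algebra of the variety. *)

theory Defs
  imports
    Complex_Main
    "HOL-Algebra.Algebraic_Closure_Type"
    "HOL-Library.Poly_Mapping"
begin

section \<open>Nonassociative complex algebras\<close>

abbreviation \<CC> :: "complex ring"
  where "\<CC> \<equiv> ring_of_type_algebra"

text \<open>
  The type \<^typ>\<open>('a, 'b) module\<close> extends \<^typ>\<open>'b ring\<close> and therefore carries a field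
  \<^const>\<open>one\<close>.  As in the locale \<^locale>\<open>module\<close>, this field is ignored throughout:
  algebras need be neither associative nor unital.
\<close>

locale complex_algebra = module \<CC> A for A :: "(complex, 'a) module" (structure) +
  assumes mult_closed [simp, intro]:
      "\<lbrakk>x \<in> carrier A; y \<in> carrier A\<rbrakk> \<Longrightarrow> x \<otimes> y \<in> carrier A"
    and mult_add_left:
      "\<lbrakk>x \<in> carrier A; y \<in> carrier A; z \<in> carrier A\<rbrakk> \<Longrightarrow> (x \<oplus> y) \<otimes> z = x \<otimes> z \<oplus> y \<otimes> z"
    and mult_add_right:
      "\<lbrakk>x \<in> carrier A; y \<in> carrier A; z \<in> carrier A\<rbrakk> \<Longrightarrow> x \<otimes> (y \<oplus> z) = x \<otimes> y \<oplus> x \<otimes> z"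
    and mult_smult_left:
      "\<lbrakk>x \<in> carrier A; y \<in> carrier A\<rbrakk> \<Longrightarrow> (c \<odot> x) \<otimes> y = c \<odot> (x \<otimes> y)"
    and mult_smult_right:
      "\<lbrakk>x \<in> carrier A; y \<in> carrier A\<rbrakk> \<Longrightarrow> x \<otimes> (c \<odot> y) = c \<odot> (x \<otimes> y)"

locale delta_novikov = complex_algebra A for \<delta> :: complex and A :: "(complex, 'a) module" (structure) +
  assumes delta_left_symmetric:
      "\<lbrakk>x \<in> carrier A; y \<in> carrier A; z \<in> carrier A\<rbrakk> \<Longrightarrow>
        \<delta> \<odot> ((x \<otimes> y) \<otimes> z) \<ominus> x \<otimes> (y \<otimes> z) = \<delta> \<odot> ((y \<otimes> x) \<otimes> z) \<ominus> y \<otimes> (x \<otimes> z)"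
    and right_commutative:
      "\<lbrakk>x \<in> carrier A; y \<in> carrier A; z \<in> carrier A\<rbrakk> \<Longrightarrow> (x \<otimes> y) \<otimes> z = (x \<otimes> z) \<otimes> y"

definition is_subalgebra :: "'a set \<Rightarrow> (complex, 'a) module \<Rightarrow> bool"
  where "is_subalgebra S A \<longleftrightarrow>
    submodule S \<CC> A \<and> (\<forall>x\<in>S. \<forall>y\<in>S. x \<otimes>\<^bsub>A\<^esub> y \<in> S)"

definition algebra_ideal :: "'a set \<Rightarrow> (complex, 'a) module \<Rightarrow> bool"
  where "algebra_ideal I A \<longleftrightarrow>
    submodule I \<CC> A \<and> (\<forall>x\<in>I. \<forall>a\<in>carrier A. a \<otimes>\<^bsub>A\<^esub> x \<in> I \<and> x \<otimes>\<^bsub>A\<^esub> a \<in> I)"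

definition algebra_hom :: "(complex, 'a) module \<Rightarrow> (complex, 'b) module \<Rightarrow> ('a \<Rightarrow> 'b) set"
  where "algebra_hom A B =
    {h \<in> carrier A \<rightarrow> carrier B.
      (\<forall>x\<in>carrier A. \<forall>y\<in>carrier A. h (x \<oplus>\<^bsub>A\<^esub> y) = h x \<oplus>\<^bsub>B\<^esub> h y) \<and>
      (\<forall>c. \<forall>x\<in>carrier A. h (c \<odot>\<^bsub>A\<^esub> x) = c \<odot>\<^bsub>B\<^esub> h x) \<and>
      (\<forall>x\<in>carrier A. \<forall>y\<in>carrier A. h (x \<otimes>\<^bsub>A\<^esub> y) = h x \<otimes>\<^bsub>B\<^esub> h y)}"

definition algebra_isomorphic :: "(complex, 'a) module \<Rightarrow> (complex, 'b) module \<Rightarrow> bool"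
  where "algebra_isomorphic A B \<longleftrightarrow> (\<exists>h\<in>algebra_hom A B. bij_betw h (carrier A) (carrier B))"

definition quotient_algebra :: "(complex, 'a) module \<Rightarrow> 'a set \<Rightarrow> (complex, 'a set) module"
  where "quotient_algebra A I =
    \<lparr>carrier = a_rcosets\<^bsub>A\<^esub> I, monoid.mult = rcoset_mult A I, one = I +>\<^bsub>A\<^esub> \<one>\<^bsub>A\<^esub>,
     zero = I, add = set_add A, module.smult = (\<lambda>c K. \<Union>x\<in>K. I +>\<^bsub>A\<^esub> (c \<odot>\<^bsub>A\<^esub> x))\<rparr>"


section \<open>Free \<open>\<delta>\<close>-Novikov algebras\<close>

datatype 'x magma = Gen 'x | Mul "'x magma" "'x magma"

lift_definition magma_poly_mult ::
    "('x magma \<Rightarrow>\<^sub>0 complex) \<Rightarrow> ('x magma \<Rightarrow>\<^sub>0 complex) \<Rightarrow> ('x magma \<Rightarrow>\<^sub>0 complex)"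
  is "\<lambda>p q m. case m of Gen _ \<Rightarrow> 0 | Mul s t \<Rightarrow> p s * q t"
proof -
  fix p q :: "'x magma \<Rightarrow> complex"
  assume "finite {m. p m \<noteq> 0}" and "finite {m. q m \<noteq> 0}"
  then have "finite ((\<lambda>(s, t). Mul s t) ` ({m. p m \<noteq> 0} \<times> {m. q m \<noteq> 0}))"
    by simp
  moreover have "{m. (case m of Gen _ \<Rightarrow> 0 | Mul s t \<Rightarrow> p s * q t) \<noteq> 0} \<subseteq>
      (\<lambda>(s, t). Mul s t) ` ({m. p m \<noteq> 0} \<times> {m. q m \<noteq> 0})"
  proof
    fix m assume "m \<in> {m. (case m of Gen _ \<Rightarrow> 0 | Mul s t \<Rightarrow> p s * q t) \<noteq> 0}"
    then show "m \<in> (\<lambda>(s, t). Mul s t) ` ({m. p m \<noteq> 0} \<times> {m. q m \<noteq> 0})"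
      by (cases m) auto
  qed
  ultimately show "finite {m. (case m of Gen _ \<Rightarrow> 0 | Mul s t \<Rightarrow> p s * q t) \<noteq> 0}"
    by (rule finite_subset[rotated])
qed

text \<open>
  The free nonassociative algebra on \<open>V\<close>: the complex vector space with basis the nonassociative
  words with letters in \<open>V\<close> (a word being either a letter or, uniquely, a product of two words).
\<close>

definition free_nonassoc_algebra :: "'x set \<Rightarrow> (complex, 'x magma \<Rightarrow>\<^sub>0 complex) module"
  where "free_nonassoc_algebra V =
    \<lparr>carrier = {p. \<forall>m\<in>Poly_Mapping.keys p. set_magma m \<subseteq> V}, monoid.mult = magma_poly_mult, one = 0,
     zero = 0, add = (+), module.smult = (\<lambda>c. Poly_Mapping.map ((*) c))\<rparr>"

text \<open>
  The free \<open>\<delta>\<close>-Novikov algebra on \<open>V\<close> is the largest \<open>\<delta>\<close>-Novikov quotient of the free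
  nonassociative algebra on \<open>V\<close>; see \<open>free_delta_novikov_universal\<close> below for its universal property.
\<close>

definition delta_novikov_ideal :: "complex \<Rightarrow> 'x set \<Rightarrow> ('x magma \<Rightarrow>\<^sub>0 complex) set"
  where "delta_novikov_ideal \<delta> V =
    \<Inter>{I. algebra_ideal I (free_nonassoc_algebra V) \<and>
        delta_novikov \<delta> (quotient_algebra (free_nonassoc_algebra V) I)}"

definition free_delta_novikov ::
    "complex \<Rightarrow> 'x set \<Rightarrow> (complex, ('x magma \<Rightarrow>\<^sub>0 complex) set) module"
  where "free_delta_novikov \<delta> V =
    quotient_algebra (free_nonassoc_algebra V) (delta_novikov_ideal \<delta> V)"


section \<open>The universal property\<close>

lemma CC_simps [simp]:
  "carrier \<CC> = UNIV" "x \<oplus>\<^bsub>\<CC>\<^esub> y = x + y" "x \<otimes>\<^bsub>\<CC>\<^esub> y = x * y" "\<zero>\<^bsub>\<CC>\<^esub> = 0" "\<one>\<^bsub>\<CC>\<^esub> = 1"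
  by (simp_all add: ring_of_type_algebra_def)

lemma complex_algebraI:
  assumes "abelian_group A"
    and "\<And>c x. x \<in> carrier A \<Longrightarrow> c \<odot>\<^bsub>A\<^esub> x \<in> carrier A"
    and "\<And>c d x. x \<in> carrier A \<Longrightarrow> (c + d) \<odot>\<^bsub>A\<^esub> x = c \<odot>\<^bsub>A\<^esub> x \<oplus>\<^bsub>A\<^esub> d \<odot>\<^bsub>A\<^esub> x"
    and "\<And>c x y. \<lbrakk>x \<in> carrier A; y \<in> carrier A\<rbrakk> \<Longrightarrow> c \<odot>\<^bsub>A\<^esub> (x \<oplus>\<^bsub>A\<^esub> y) = c \<odot>\<^bsub>A\<^esub> x \<oplus>\<^bsub>A\<^esub> c \<odot>\<^bsub>A\<^esub> y"
    and "\<And>c d x. x \<in> carrier A \<Longrightarrow> (c * d) \<odot>\<^bsub>A\<^esub> x = c \<odot>\<^bsub>A\<^esub> (d \<odot>\<^bsub>A\<^esub> x)"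
    and "\<And>x. x \<in> carrier A \<Longrightarrow> 1 \<odot>\<^bsub>A\<^esub> x = x"
    and "\<And>x y. \<lbrakk>x \<in> carrier A; y \<in> carrier A\<rbrakk> \<Longrightarrow> x \<otimes>\<^bsub>A\<^esub> y \<in> carrier A"
    and "\<And>x y z. \<lbrakk>x \<in> carrier A; y \<in> carrier A; z \<in> carrier A\<rbrakk> \<Longrightarrow>
      (x \<oplus>\<^bsub>A\<^esub> y) \<otimes>\<^bsub>A\<^esub> z = x \<otimes>\<^bsub>A\<^esub> z \<oplus>\<^bsub>A\<^esub> y \<otimes>\<^bsub>A\<^esub> z"
    and "\<And>x y z. \<lbrakk>x \<in> carrier A; y \<in> carrier A; z \<in> carrier A\<rbrakk> \<Longrightarrow>
      x \<otimes>\<^bsub>A\<^esub> (y \<oplus>\<^bsub>A\<^esub> z) = x \<otimes>\<^bsub>A\<^esub> y \<oplus>\<^bsub>A\<^esub> x \<otimes>\<^bsub>A\<^esub> z"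
    and "\<And>c x y. \<lbrakk>x \<in> carrier A; y \<in> carrier A\<rbrakk> \<Longrightarrow> (c \<odot>\<^bsub>A\<^esub> x) \<otimes>\<^bsub>A\<^esub> y = c \<odot>\<^bsub>A\<^esub> (x \<otimes>\<^bsub>A\<^esub> y)"
    and "\<And>c x y. \<lbrakk>x \<in> carrier A; y \<in> carrier A\<rbrakk> \<Longrightarrow> x \<otimes>\<^bsub>A\<^esub> (c \<odot>\<^bsub>A\<^esub> y) = c \<odot>\<^bsub>A\<^esub> (x \<otimes>\<^bsub>A\<^esub> y)"
  shows "complex_algebra A"
  using assms
  by (auto intro!: complex_algebra.intro moduleI complex_algebra_axioms.intro cring_from_type_algebra)

lemma lookup_magma_poly_mult [simp]:
  "Poly_Mapping.lookup (magma_poly_mult p q) (Gen v) = 0"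
  "Poly_Mapping.lookup (magma_poly_mult p q) (Mul s t) = Poly_Mapping.lookup p s * Poly_Mapping.lookup q t"
  by (transfer; simp)+

lemma lookup_map_scale [simp]: "Poly_Mapping.lookup (Poly_Mapping.map ((*) c) p) m = c * (Poly_Mapping.lookup p m :: complex)"
  by (transfer) (auto simp: when_def)

lemma free_nonassoc_algebra_simps [simp]:
  "x \<oplus>\<^bsub>free_nonassoc_algebra V\<^esub> y = x + y"
  "x \<otimes>\<^bsub>free_nonassoc_algebra V\<^esub> y = magma_poly_mult x y"
  "c \<odot>\<^bsub>free_nonassoc_algebra V\<^esub> x = Poly_Mapping.map ((*) c) x"
  "\<zero>\<^bsub>free_nonassoc_algebra V\<^esub> = 0"
  by (simp_all add: free_nonassoc_algebra_def)

lemma carrier_free_nonassoc_algebra: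
  "p \<in> carrier (free_nonassoc_algebra V) \<longleftrightarrow> (\<forall>m. Poly_Mapping.lookup p m \<noteq> 0 \<longrightarrow> set_magma m \<subseteq> V)"
  by (auto simp add: free_nonassoc_algebra_def Poly_Mapping.in_keys_iff)

lemma complex_algebra_free_nonassoc_algebra: "complex_algebra (free_nonassoc_algebra V)"
proof (rule complex_algebraI)
  show "abelian_group (free_nonassoc_algebra V)"
  proof (rule abelian_groupI)
    fix x assume "x \<in> carrier (free_nonassoc_algebra V)"
    then show "\<exists>y\<in>carrier (free_nonassoc_algebra V).
        y \<oplus>\<^bsub>free_nonassoc_algebra V\<^esub> x = \<zero>\<^bsub>free_nonassoc_algebra V\<^esub>"
      by (intro bexI[of _ "- x"]) (auto simp: carrier_free_nonassoc_algebra)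
  next
    fix x y assume "x \<in> carrier (free_nonassoc_algebra V)" "y \<in> carrier (free_nonassoc_algebra V)"
    then show "x \<oplus>\<^bsub>free_nonassoc_algebra V\<^esub> y \<in> carrier (free_nonassoc_algebra V)"
      using keys_add[of x y] by (auto simp: free_nonassoc_algebra_def)
  qed (auto simp: carrier_free_nonassoc_algebra algebra_simps)
next
  fix x y assume "x \<in> carrier (free_nonassoc_algebra V)" "y \<in> carrier (free_nonassoc_algebra V)"
  then show "x \<otimes>\<^bsub>free_nonassoc_algebra V\<^esub> y \<in> carrier (free_nonassoc_algebra V)"
    unfolding carrier_free_nonassoc_algebra
  proof (intro allI impI)
    fix m assume *: "Poly_Mapping.lookup (x \<otimes>\<^bsub>free_nonassoc_algebra V\<^esub> y) m \<noteq> 0"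
      "\<forall>m. Poly_Mapping.lookup x m \<noteq> 0 \<longrightarrow> set_magma m \<subseteq> V" "\<forall>m. Poly_Mapping.lookup y m \<noteq> 0 \<longrightarrow> set_magma m \<subseteq> V"
    then show "set_magma m \<subseteq> V" by (cases m) auto
  qed
next
  fix x y z :: "'a magma \<Rightarrow>\<^sub>0 complex"
  show "(x \<oplus>\<^bsub>free_nonassoc_algebra V\<^esub> y) \<otimes>\<^bsub>free_nonassoc_algebra V\<^esub> z =
      x \<otimes>\<^bsub>free_nonassoc_algebra V\<^esub> z \<oplus>\<^bsub>free_nonassoc_algebra V\<^esub> y \<otimes>\<^bsub>free_nonassoc_algebra V\<^esub> z"
  proof (rule poly_mapping_eqI)
    fix m show "Poly_Mapping.lookup ((x \<oplus>\<^bsub>free_nonassoc_algebra V\<^esub> y) \<otimes>\<^bsub>free_nonassoc_algebra V\<^esub> z) m =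
      Poly_Mapping.lookup (x \<otimes>\<^bsub>free_nonassoc_algebra V\<^esub> z \<oplus>\<^bsub>free_nonassoc_algebra V\<^esub> y \<otimes>\<^bsub>free_nonassoc_algebra V\<^esub> z) m"
      by (cases m) (auto simp: lookup_add algebra_simps)
  qed
  show "x \<otimes>\<^bsub>free_nonassoc_algebra V\<^esub> (y \<oplus>\<^bsub>free_nonassoc_algebra V\<^esub> z) =
      x \<otimes>\<^bsub>free_nonassoc_algebra V\<^esub> y \<oplus>\<^bsub>free_nonassoc_algebra V\<^esub> x \<otimes>\<^bsub>free_nonassoc_algebra V\<^esub> z"
  proof (rule poly_mapping_eqI)
    fix m show "Poly_Mapping.lookup (x \<otimes>\<^bsub>free_nonassoc_algebra V\<^esub> (y \<oplus>\<^bsub>free_nonassoc_algebra V\<^esub> z)) m =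
      Poly_Mapping.lookup (x \<otimes>\<^bsub>free_nonassoc_algebra V\<^esub> y \<oplus>\<^bsub>free_nonassoc_algebra V\<^esub> x \<otimes>\<^bsub>free_nonassoc_algebra V\<^esub> z) m"
      by (cases m) (auto simp: lookup_add algebra_simps)
  qed
  fix c
  show "(c \<odot>\<^bsub>free_nonassoc_algebra V\<^esub> x) \<otimes>\<^bsub>free_nonassoc_algebra V\<^esub> y =
      c \<odot>\<^bsub>free_nonassoc_algebra V\<^esub> (x \<otimes>\<^bsub>free_nonassoc_algebra V\<^esub> y)"
  proof (rule poly_mapping_eqI)
    fix m show "Poly_Mapping.lookup ((c \<odot>\<^bsub>free_nonassoc_algebra V\<^esub> x) \<otimes>\<^bsub>free_nonassoc_algebra V\<^esub> y) m =
      Poly_Mapping.lookup (c \<odot>\<^bsub>free_nonassoc_algebra V\<^esub> (x \<otimes>\<^bsub>free_nonassoc_algebra V\<^esub> y)) m"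
      by (cases m) auto
  qed
  show "x \<otimes>\<^bsub>free_nonassoc_algebra V\<^esub> (c \<odot>\<^bsub>free_nonassoc_algebra V\<^esub> y) =
      c \<odot>\<^bsub>free_nonassoc_algebra V\<^esub> (x \<otimes>\<^bsub>free_nonassoc_algebra V\<^esub> y)"
  proof (rule poly_mapping_eqI)
    fix m show "Poly_Mapping.lookup (x \<otimes>\<^bsub>free_nonassoc_algebra V\<^esub> (c \<odot>\<^bsub>free_nonassoc_algebra V\<^esub> y)) m =
      Poly_Mapping.lookup (c \<odot>\<^bsub>free_nonassoc_algebra V\<^esub> (x \<otimes>\<^bsub>free_nonassoc_algebra V\<^esub> y)) m"
      by (cases m) auto
  qed
qed (auto simp: carrier_free_nonassoc_algebra lookup_add algebra_simps intro!: poly_mapping_eqI)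

context complex_algebra
begin

context
  fixes I assumes I: "algebra_ideal I A"
begin

lemma ideal_sub: "I \<subseteq> carrier A" 
  using I submoduleE(1) by (simp add: algebra_ideal_def)

lemma ideal_abelian_subgroup: "abelian_subgroup I A"
  using I M.abelian_group_axioms unfolding algebra_ideal_def submodule_def
  by (auto intro!: abelian_subgroupI3 additive_subgroupI)

interpretation abelian_subgroup I A by (rule ideal_abelian_subgroup)

lemma coset_eq_iff:
  assumes "x \<in> carrier A" "y \<in> carrier A"
  shows "I +> x = I +> y \<longleftrightarrow> x \<ominus> y \<in> I"
proof
  assume "I +> x = I +> y"
  then have "I +> (x \<ominus> y) = I"
    unfolding a_minus_def by (rule M.a_coset_add_inv2) (use assms ideal_sub in auto)
  then show "x \<ominus> y \<in> I"
    by (rule M.a_coset_join1) (use assms a_subgroup in auto)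
next
  assume "x \<ominus> y \<in> I"
  then have "I +> (x \<ominus> y) = I"
    by (intro M.a_coset_join2) (use assms a_subgroup in auto)
  then show "I +> x = I +> y"
    unfolding a_minus_def by (rule M.a_coset_add_inv1) (use assms ideal_sub in auto)
qed

lemma quotient_add: 
  assumes "x \<in> carrier A" "y \<in> carrier A"
  shows "(I +> x) \<oplus>\<^bsub>quotient_algebra A I\<^esub> (I +> y) = I +> (x \<oplus> y)"
  using assms by (simp add: quotient_algebra_def a_rcos_sum)

lemma ideal_add: "x \<in> I \<Longrightarrow> y \<in> I \<Longrightarrow> x \<oplus> y \<in> I" by simp
lemma ideal_smult: "x \<in> I \<Longrightarrow> c \<odot> x \<in> I"
  using I submoduleE(4) by (auto simp add: algebra_ideal_def)

lemma quotient_mult: 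
  assumes "x \<in> carrier A" "y \<in> carrier A"
  shows "(I +> x) \<otimes>\<^bsub>quotient_algebra A I\<^esub> (I +> y) = I +> (x \<otimes> y)"
proof -
  have "I +> a \<otimes> b = I +> x \<otimes> y" if ab: "a \<in> I +> x" "b \<in> I +> y" for a b
  proof -
    obtain i j where ij: "i \<in> I" "j \<in> I" "a = i \<oplus> x" "b = j \<oplus> y"
      using ab by (auto simp: a_r_coset_def')
    have "i \<in> carrier A" "j \<in> carrier A" using ij ideal_sub by auto
    note c = this assms
    have "a \<otimes> b = (i \<otimes> b \<oplus> x \<otimes> j) \<oplus> x \<otimes> y"
      using c ij by (simp add: mult_add_left mult_add_right M.a_ac)
    moreover have "i \<otimes> b \<oplus> x \<otimes> j \<in> I"
      using I c ij by (intro ideal_add) (auto simp: algebra_ideal_def)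
    ultimately have "a \<otimes> b \<in> I +> x \<otimes> y"
      by (auto simp: a_r_coset_def')
    then show ?thesis using c by (metis a_repr_independence' mult_closed)
  qed
  then have "(\<Union>a\<in>I +> x. \<Union>b\<in>I +> y. I +> a \<otimes> b) = (\<Union>a\<in>I +> x. \<Union>b\<in>I +> y. I +> x \<otimes> y)"
    by (intro SUP_cong refl)
  moreover have "I +> x \<noteq> {}" "I +> y \<noteq> {}" using assms a_rcos_self by blast+
  ultimately show ?thesis
    by (simp add: quotient_algebra_def rcoset_mult_def)
qed

lemma quotient_smult: 
  assumes "x \<in> carrier A"
  shows "c \<odot>\<^bsub>quotient_algebra A I\<^esub> (I +> x) = I +> (c \<odot> x)"
proof -
  have "I +> c \<odot> a = I +> c \<odot> x" if ab: "a \<in> I +> x" for a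
  proof -
    obtain i where ij: "i \<in> I" "a = i \<oplus> x"
      using ab by (auto simp: a_r_coset_def')
    have "i \<in> carrier A" using ij ideal_sub by auto
    note c = this assms
    have "c \<odot> a = c \<odot> i \<oplus> c \<odot> x"
      using c ij by (simp add: smult_r_distr)
    then have "c \<odot> a \<in> I +> c \<odot> x" using ideal_smult ij
      by (auto simp: a_r_coset_def')
    then show ?thesis using c by (metis a_repr_independence' smult_closed CC_simps(1) UNIV_I)
  qed
  then have "(\<Union>a\<in>I +> x. I +> c \<odot> a) = (\<Union>a\<in>I +> x. I +> c \<odot> x)"
    by (intro SUP_cong refl)
  moreover have "I +> x \<noteq> {}" using assms a_rcos_self by blast
  ultimately show ?thesis
    by (simp add: quotient_algebra_def)
qed

lemma quotient_carrier: "carrier (quotient_algebra A I) = (\<lambda>x. I +> x) ` carrier A"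
  by (auto simp: quotient_algebra_def A_RCOSETS_def')

lemma quotient_zero: "\<zero>\<^bsub>quotient_algebra A I\<^esub> = I +> \<zero>"
  using ideal_sub by (simp add: quotient_algebra_def)

lemma complex_algebra_quotient: "complex_algebra (quotient_algebra A I)"
proof (rule complex_algebraI)
  show "abelian_group (quotient_algebra A I)"
  proof (rule abelian_groupI)
    fix x assume "x \<in> carrier (quotient_algebra A I)"
    then obtain a where "a \<in> carrier A" "x = I +> a" by (auto simp: quotient_carrier)
    then show "\<exists>y\<in>carrier (quotient_algebra A I).
        y \<oplus>\<^bsub>quotient_algebra A I\<^esub> x = \<zero>\<^bsub>quotient_algebra A I\<^esub>"
      by (intro bexI[of _ "I +> (\<ominus> a)"])
        (auto simp: quotient_carrier quotient_add quotient_zero M.l_neg)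
  qed (auto simp: quotient_carrier quotient_add quotient_zero M.a_ac)
qed (auto simp: quotient_carrier quotient_add quotient_mult quotient_smult smult_l_distr[simplified]
    smult_r_distr smult_assoc1[simplified] smult_one[simplified] mult_add_left mult_add_right mult_smult_left mult_smult_right)

lemma quotient_minus:
  assumes "x \<in> carrier A" "y \<in> carrier A"
  shows "(I +> x) \<ominus>\<^bsub>quotient_algebra A I\<^esub> (I +> y) = I +> (x \<ominus> y)"
proof -
  interpret Q: complex_algebra "quotient_algebra A I" by (rule complex_algebra_quotient)
  have "\<ominus>\<^bsub>quotient_algebra A I\<^esub> (I +> y) = I +> (\<ominus> y)"
    using assms by (intro Q.M.minus_equality) (auto simp: quotient_carrier quotient_add quotient_zero M.l_neg)
  then show ?thesis using assms by (simp add: a_minus_def quotient_add)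
qed

lemma delta_novikov_quotient_iff:
  "delta_novikov \<delta> (quotient_algebra A I) \<longleftrightarrow>
    (\<forall>x\<in>carrier A. \<forall>y\<in>carrier A. \<forall>z\<in>carrier A.
      (\<delta> \<odot> ((x \<otimes> y) \<otimes> z) \<ominus> x \<otimes> (y \<otimes> z)) \<ominus> (\<delta> \<odot> ((y \<otimes> x) \<otimes> z) \<ominus> y \<otimes> (x \<otimes> z)) \<in> I \<and>
      (x \<otimes> y) \<otimes> z \<ominus> (x \<otimes> z) \<otimes> y \<in> I)"
proof -
  have *: "delta_novikov \<delta> (quotient_algebra A I) \<longleftrightarrow>
    (\<forall>x\<in>carrier (quotient_algebra A I). \<forall>y\<in>carrier (quotient_algebra A I). \<forall>z\<in>carrier (quotient_algebra A I).
      \<delta> \<odot>\<^bsub>quotient_algebra A I\<^esub> ((x \<otimes>\<^bsub>quotient_algebra A I\<^esub> y) \<otimes>\<^bsub>quotient_algebra A I\<^esub> z)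
        \<ominus>\<^bsub>quotient_algebra A I\<^esub> x \<otimes>\<^bsub>quotient_algebra A I\<^esub> (y \<otimes>\<^bsub>quotient_algebra A I\<^esub> z) =
      \<delta> \<odot>\<^bsub>quotient_algebra A I\<^esub> ((y \<otimes>\<^bsub>quotient_algebra A I\<^esub> x) \<otimes>\<^bsub>quotient_algebra A I\<^esub> z)
        \<ominus>\<^bsub>quotient_algebra A I\<^esub> y \<otimes>\<^bsub>quotient_algebra A I\<^esub> (x \<otimes>\<^bsub>quotient_algebra A I\<^esub> z) \<and>
      (x \<otimes>\<^bsub>quotient_algebra A I\<^esub> y) \<otimes>\<^bsub>quotient_algebra A I\<^esub> z =
      (x \<otimes>\<^bsub>quotient_algebra A I\<^esub> z) \<otimes>\<^bsub>quotient_algebra A I\<^esub> y)"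
    by (auto simp: delta_novikov_def delta_novikov_axioms_def complex_algebra_quotient)
  have **: "\<delta> \<odot>\<^bsub>quotient_algebra A I\<^esub> (((I +> x) \<otimes>\<^bsub>quotient_algebra A I\<^esub> (I +> y)) \<otimes>\<^bsub>quotient_algebra A I\<^esub> (I +> z))
        \<ominus>\<^bsub>quotient_algebra A I\<^esub> (I +> x) \<otimes>\<^bsub>quotient_algebra A I\<^esub> ((I +> y) \<otimes>\<^bsub>quotient_algebra A I\<^esub> (I +> z)) =
      \<delta> \<odot>\<^bsub>quotient_algebra A I\<^esub> (((I +> y) \<otimes>\<^bsub>quotient_algebra A I\<^esub> (I +> x)) \<otimes>\<^bsub>quotient_algebra A I\<^esub> (I +> z))
        \<ominus>\<^bsub>quotient_algebra A I\<^esub> (I +> y) \<otimes>\<^bsub>quotient_algebra A I\<^esub> ((I +> x) \<otimes>\<^bsub>quotient_algebra A I\<^esub> (I +> z)) \<longleftrightarrow>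
      (\<delta> \<odot> ((x \<otimes> y) \<otimes> z) \<ominus> x \<otimes> (y \<otimes> z)) \<ominus> (\<delta> \<odot> ((y \<otimes> x) \<otimes> z) \<ominus> y \<otimes> (x \<otimes> z)) \<in> I"
    "((I +> x) \<otimes>\<^bsub>quotient_algebra A I\<^esub> (I +> y)) \<otimes>\<^bsub>quotient_algebra A I\<^esub> (I +> z) = ((I +> x) \<otimes>\<^bsub>quotient_algebra A I\<^esub> (I +> z)) \<otimes>\<^bsub>quotient_algebra A I\<^esub> (I +> y) \<longleftrightarrow>
      (x \<otimes> y) \<otimes> z \<ominus> (x \<otimes> z) \<otimes> y \<in> I"
    if "x \<in> carrier A" "y \<in> carrier A" "z \<in> carrier A" for x y z
    using that by (simp_all add: quotient_mult quotient_smult quotient_minus coset_eq_iff[symmetric])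
  show ?thesis
    unfolding * quotient_carrier ball_simps by (intro ball_cong refl conj_cong) (simp_all only: **)
qed
end

end


lemma algebra_ideal_delta_novikov_ideal:
  "algebra_ideal (delta_novikov_ideal \<delta> V) (free_nonassoc_algebra V)" (is ?A)
  and delta_novikov_free_delta_novikov: "delta_novikov \<delta> (free_delta_novikov \<delta> V)" (is ?B)
proof -
  interpret F: complex_algebra "free_nonassoc_algebra V" by (rule complex_algebra_free_nonassoc_algebra)
  let ?S = "{I. algebra_ideal I (free_nonassoc_algebra V) \<and>
        delta_novikov \<delta> (quotient_algebra (free_nonassoc_algebra V) I)}"
  have car: "algebra_ideal (carrier (free_nonassoc_algebra V)) (free_nonassoc_algebra V)"
    using F.carrier_is_submodule F.mult_closed by (auto simp: algebra_ideal_def)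
  have "delta_novikov \<delta> (quotient_algebra (free_nonassoc_algebra V) (carrier (free_nonassoc_algebra V)))"
    unfolding F.delta_novikov_quotient_iff[OF car]
    by (intro ballI conjI F.M.minus_closed F.smult_closed F.mult_closed) auto
  with car have carS: "carrier (free_nonassoc_algebra V) \<in> ?S" by blast
  have sub: "submodule I \<CC> (free_nonassoc_algebra V)" if "I \<in> ?S" for I
    using that by (auto simp: algebra_ideal_def)
  have "submodule (\<Inter> ?S) \<CC> (free_nonassoc_algebra V)"
  proof (rule F.submoduleI)
    show "\<Inter> ?S \<subseteq> carrier (free_nonassoc_algebra V)" using carS by blast
    show "\<zero>\<^bsub>free_nonassoc_algebra V\<^esub> \<in> \<Inter> ?S"
      using sub subgroup.one_closed by (fastforce simp: submodule_def)
  qed (use sub F.submoduleE(3,4,5) in blast)+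
  then show A: ?A
    unfolding algebra_ideal_def delta_novikov_ideal_def by (auto simp: algebra_ideal_def)
  show ?B
    unfolding free_delta_novikov_def F.delta_novikov_quotient_iff[OF A]
    unfolding delta_novikov_ideal_def
    using F.delta_novikov_quotient_iff by blast
qed

lemma free_nonassoc_algebra_induct [consumes 1, case_names zero single add]:
  assumes "p \<in> carrier (free_nonassoc_algebra V)"
    and "P 0"
    and "\<And>c m. set_magma m \<subseteq> V \<Longrightarrow> P (Poly_Mapping.single m c)"
    and "\<And>p q. \<lbrakk>p \<in> carrier (free_nonassoc_algebra V); q \<in> carrier (free_nonassoc_algebra V); P p; P q\<rbrakk> \<Longrightarrow> P (p + q)"
  shows "P p"
proof -
  have "P p" if "finite K" "Poly_Mapping.keys p \<subseteq> K" "\<forall>m\<in>K. set_magma m \<subseteq> V" for K p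
    using that
  proof (induction K arbitrary: p)
    case empty
    then show ?case using assms(2) by simp
  next
    case (insert m K)
    define q where "q = p - Poly_Mapping.single m (Poly_Mapping.lookup p m)"
    have q: "Poly_Mapping.keys q \<subseteq> K"
      using insert by (auto simp: q_def Poly_Mapping.in_keys_iff lookup_minus lookup_single when_def split: if_splits)
    then have "P q" using insert by auto
    moreover have "P (Poly_Mapping.single m (Poly_Mapping.lookup p m))" using insert assms(3) by auto
    moreover have "q \<in> carrier (free_nonassoc_algebra V)" 
      "Poly_Mapping.single m (Poly_Mapping.lookup p m) \<in> carrier (free_nonassoc_algebra V)"
      using q insert by (auto simp: free_nonassoc_algebra_def)
    ultimately have "P (q + Poly_Mapping.single m (Poly_Mapping.lookup p m))" using assms(4) by blast
    then show ?case by (simp add: q_def)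
  qed
  from this[of "Poly_Mapping.keys p"] assms(1) show ?thesis by (auto simp: free_nonassoc_algebra_def)
qed

lemma magma_poly_mult_single [simp]:
  "magma_poly_mult (Poly_Mapping.single s a) (Poly_Mapping.single t b) = Poly_Mapping.single (Mul s t) (a * b)"
proof (rule poly_mapping_eqI)
  fix m show "Poly_Mapping.lookup (magma_poly_mult (Poly_Mapping.single s a) (Poly_Mapping.single t b)) m =
    Poly_Mapping.lookup (Poly_Mapping.single (Mul s t) (a * b)) m"
    by (cases m) (auto simp: lookup_single when_def)
qed

lemma single_carrier [simp]: "set_magma m \<subseteq> V \<Longrightarrow> Poly_Mapping.single m c \<in> carrier (free_nonassoc_algebra V)"
  by (auto simp: free_nonassoc_algebra_def)

context complex_algebra
begin

primrec eval_magma :: "('x \<Rightarrow> 'a) \<Rightarrow> 'x magma \<Rightarrow> 'a" where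
  "eval_magma f (Gen v) = f v"
| "eval_magma f (Mul s t) = eval_magma f s \<otimes> eval_magma f t"

definition eval_magma_poly :: "('x \<Rightarrow> 'a) \<Rightarrow> ('x magma \<Rightarrow>\<^sub>0 complex) \<Rightarrow> 'a" where
  "eval_magma_poly f p = finsum A (\<lambda>m. Poly_Mapping.lookup p m \<odot> eval_magma f m) (Poly_Mapping.keys p)"

context
  fixes f :: "'x \<Rightarrow> 'a" and V :: "'x set"
  assumes f: "f \<in> V \<rightarrow> carrier A"
begin

lemma eval_magma_closed: "set_magma m \<subseteq> V \<Longrightarrow> eval_magma f m \<in> carrier A"
  using f by (induction m) auto

lemma eval_magma_poly_superset:
  assumes "finite K" "Poly_Mapping.keys p \<subseteq> K" "\<forall>m\<in>K. set_magma m \<subseteq> V"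
  shows "eval_magma_poly f p = finsum A (\<lambda>m. Poly_Mapping.lookup p m \<odot> eval_magma f m) K"
  unfolding eval_magma_poly_def
  using assms smult_l_null
  by (intro M.add.finprod_mono_neutral_cong_left) (auto simp: eval_magma_closed Poly_Mapping.in_keys_iff)

lemma eval_magma_poly_closed: "p \<in> carrier (free_nonassoc_algebra V) \<Longrightarrow> eval_magma_poly f p \<in> carrier A"
  unfolding eval_magma_poly_def
  by (intro M.finsum_closed) (auto simp: free_nonassoc_algebra_def eval_magma_closed)

lemma eval_magma_poly_add:
  assumes "p \<in> carrier (free_nonassoc_algebra V)" "q \<in> carrier (free_nonassoc_algebra V)"
  shows "eval_magma_poly f (p + q) = eval_magma_poly f p \<oplus> eval_magma_poly f q"
proof -
  let ?K = "Poly_Mapping.keys p \<union> Poly_Mapping.keys q"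
  have K: "finite ?K" "\<forall>m\<in>?K. set_magma m \<subseteq> V"
    using assms by (auto simp: free_nonassoc_algebra_def)
  have "Poly_Mapping.keys (p + q) \<subseteq> ?K" by (rule keys_add)
  then have "eval_magma_poly f (p + q) =
      finsum A (\<lambda>m. (Poly_Mapping.lookup p m + Poly_Mapping.lookup q m) \<odot> eval_magma f m) ?K"
    using K eval_magma_poly_superset[of ?K "p + q"] by (simp only: lookup_add)
  also have "\<dots> = finsum A (\<lambda>m. Poly_Mapping.lookup p m \<odot> eval_magma f m \<oplus>
      Poly_Mapping.lookup q m \<odot> eval_magma f m) ?K"
    by (intro M.finsum_cong' refl Pi_I M.a_closed smult_closed smult_l_distr[simplified] eval_magma_closed)
      (use K in auto)
  also have "\<dots> = finsum A (\<lambda>m. Poly_Mapping.lookup p m \<odot> eval_magma f m) ?K \<oplus>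
      finsum A (\<lambda>m. Poly_Mapping.lookup q m \<odot> eval_magma f m) ?K"
    by (intro M.finsum_addf Pi_I smult_closed eval_magma_closed) (use K in auto)
  also have "\<dots> = eval_magma_poly f p \<oplus> eval_magma_poly f q"
    using K eval_magma_poly_superset[of ?K p] eval_magma_poly_superset[of ?K q] by simp
  finally show ?thesis .
qed

lemma eval_magma_poly_single:
  "set_magma m \<subseteq> V \<Longrightarrow> eval_magma_poly f (Poly_Mapping.single m c) = c \<odot> eval_magma f m"
  by (subst eval_magma_poly_superset[of "{m}"]) (auto simp: eval_magma_closed)

lemma eval_magma_poly_smult:
  assumes "p \<in> carrier (free_nonassoc_algebra V)"
  shows "eval_magma_poly f (Poly_Mapping.map ((*) c) p) = c \<odot> eval_magma_poly f p"
proof -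
  have "Poly_Mapping.keys (Poly_Mapping.map ((*) c) p) \<subseteq> Poly_Mapping.keys p"
    by (auto simp: Poly_Mapping.in_keys_iff)
  moreover have K: "\<forall>m\<in>Poly_Mapping.keys p. set_magma m \<subseteq> V"
    using assms by (simp add: free_nonassoc_algebra_def)
  ultimately have "eval_magma_poly f (Poly_Mapping.map ((*) c) p) =
      finsum A (\<lambda>m. (c * Poly_Mapping.lookup p m) \<odot> eval_magma f m) (Poly_Mapping.keys p)"
    using eval_magma_poly_superset[of "Poly_Mapping.keys p" "Poly_Mapping.map ((*) c) p"]
    by (simp only: lookup_map_scale finite_keys)
  also have "\<dots> = finsum A (\<lambda>m. c \<odot> (Poly_Mapping.lookup p m \<odot> eval_magma f m)) (Poly_Mapping.keys p)"
    by (intro M.finsum_cong' refl Pi_I smult_closed smult_assoc1[simplified] eval_magma_closed)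
      (use K in auto)
  also have "\<dots> = c \<odot> eval_magma_poly f p"
    unfolding eval_magma_poly_def
    by (intro finsum_smult_ldistr[symmetric] Pi_I smult_closed eval_magma_closed) (use K in auto)
  finally show ?thesis .
qed

lemma eval_magma_poly_mult:
  assumes "p \<in> carrier (free_nonassoc_algebra V)" "q \<in> carrier (free_nonassoc_algebra V)"
  shows "eval_magma_poly f (magma_poly_mult p q) = eval_magma_poly f p \<otimes> eval_magma_poly f q"
proof -
  interpret F: complex_algebra "free_nonassoc_algebra V" by (rule complex_algebra_free_nonassoc_algebra)
  have z: "eval_magma_poly f 0 = \<zero>" by (simp add: eval_magma_poly_def)
  have zl: "\<zero> \<otimes> x = \<zero>" if "x \<in> carrier A" for x
    using mult_smult_left[of x x 0] smult_l_null that by simp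
  have zr: "x \<otimes> \<zero> = \<zero>" if "x \<in> carrier A" for x
    using mult_smult_right[of x x 0] smult_l_null that by simp
  have z1: "magma_poly_mult 0 x = 0" "magma_poly_mult x 0 = 0" for x :: "'x magma \<Rightarrow>\<^sub>0 complex"
    by (transfer, auto split: magma.splits)+
  have s: "eval_magma_poly f (magma_poly_mult (Poly_Mapping.single m c) q) =
      eval_magma_poly f (Poly_Mapping.single m c) \<otimes> eval_magma_poly f q" 
    if "set_magma m \<subseteq> V" for m c
    using assms(2)
  proof (induction rule: free_nonassoc_algebra_induct)
    case zero
    show ?case using that by (simp add: z z1 zr eval_magma_poly_closed)
  next
    case (single d t)
    show ?case using that single
      by (simp add: eval_magma_poly_single mult_smult_left mult_smult_right eval_magma_closed
        smult_assoc1[simplified, symmetric] mult.commute)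
  next
    case (add p q)
    show ?case using that add F.mult_add_right[of "Poly_Mapping.single m c" p q]
      F.mult_closed[of "Poly_Mapping.single m c" p] F.mult_closed[of "Poly_Mapping.single m c" q]
      by (simp add: eval_magma_poly_add mult_add_right eval_magma_poly_closed)
  qed
  show ?thesis using assms(1)
  proof (induction rule: free_nonassoc_algebra_induct)
    case zero
    show ?case using assms(2) by (simp add: z z1 zl eval_magma_poly_closed)
  next
    case (single c m)
    then show ?case by (rule s)
  next
    case (add p p')
    then show ?case using assms(2) F.mult_add_left[of p p' q]
      F.mult_closed[of p q] F.mult_closed[of p' q]
      by (simp add: eval_magma_poly_add mult_add_left eval_magma_poly_closed)
  qed
qed

lemma eval_magma_poly_hom: "eval_magma_poly f \<in> algebra_hom (free_nonassoc_algebra V) A"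
  by (auto simp: algebra_hom_def eval_magma_poly_closed eval_magma_poly_add eval_magma_poly_smult eval_magma_poly_mult)

end

end

lemma hom_kernel:
  assumes "complex_algebra A" "delta_novikov \<delta> B" and h: "h \<in> algebra_hom A B"
  defines "I \<equiv> {x \<in> carrier A. h x = \<zero>\<^bsub>B\<^esub>}"
  shows "algebra_ideal I A" "delta_novikov \<delta> (quotient_algebra A I)"
    "\<And>x y. \<lbrakk>x \<in> carrier A; y \<in> carrier A; x \<ominus>\<^bsub>A\<^esub> y \<in> I\<rbrakk> \<Longrightarrow> h x = h y"
proof -
  interpret A: complex_algebra A by fact
  interpret B: delta_novikov \<delta> B by fact
  have c: "\<And>x. x \<in> carrier A \<Longrightarrow> h x \<in> carrier B"
    and ad: "\<And>x y. x \<in> carrier A \<Longrightarrow> y \<in> carrier A \<Longrightarrow> h (x \<oplus>\<^bsub>A\<^esub> y) = h x \<oplus>\<^bsub>B\<^esub> h y"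
    and sm: "\<And>c x. x \<in> carrier A \<Longrightarrow> h (c \<odot>\<^bsub>A\<^esub> x) = c \<odot>\<^bsub>B\<^esub> h x"
    and mu: "\<And>x y. x \<in> carrier A \<Longrightarrow> y \<in> carrier A \<Longrightarrow> h (x \<otimes>\<^bsub>A\<^esub> y) = h x \<otimes>\<^bsub>B\<^esub> h y"
    using h by (auto simp: algebra_hom_def)
  have z: "h \<zero>\<^bsub>A\<^esub> = \<zero>\<^bsub>B\<^esub>"
    using sm[of "\<zero>\<^bsub>A\<^esub>" 0] A.smult_l_null[of "\<zero>\<^bsub>A\<^esub>"] B.smult_l_null[of "h \<zero>\<^bsub>A\<^esub>"] c by simp
  have mi: "h (\<ominus>\<^bsub>A\<^esub> x) = \<ominus>\<^bsub>B\<^esub> h x" if "x \<in> carrier A" for x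
    using that ad[of "\<ominus>\<^bsub>A\<^esub> x" x] c by (intro B.M.minus_equality[symmetric]) (auto simp: z A.M.l_neg)
  have su: "h (x \<ominus>\<^bsub>A\<^esub> y) = h x \<ominus>\<^bsub>B\<^esub> h y" if "x \<in> carrier A" "y \<in> carrier A" for x y
    using that by (simp add: a_minus_def ad mi)
  have zl: "\<zero>\<^bsub>B\<^esub> \<otimes>\<^bsub>B\<^esub> x = \<zero>\<^bsub>B\<^esub>" if "x \<in> carrier B" for x
    using B.mult_smult_left[of x x 0] B.smult_l_null that by simp
  have zr: "x \<otimes>\<^bsub>B\<^esub> \<zero>\<^bsub>B\<^esub> = \<zero>\<^bsub>B\<^esub>" if "x \<in> carrier B" for x
    using B.mult_smult_right[of x x 0] B.smult_l_null that by simp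
  have re: "a \<ominus>\<^bsub>B\<^esub> b = \<zero>\<^bsub>B\<^esub> \<longleftrightarrow> a = b" if "a \<in> carrier B" "b \<in> carrier B" for a b
  proof
    assume "a \<ominus>\<^bsub>B\<^esub> b = \<zero>\<^bsub>B\<^esub>"
    then have "\<ominus>\<^bsub>B\<^esub> (\<ominus>\<^bsub>B\<^esub> b) = a"
      unfolding a_minus_def by (rule B.M.minus_equality) (use that in auto)
    then show "a = b" using that by simp
  qed (use that B.M.r_neg in \<open>simp add: a_minus_def\<close>)
  have zs: "a \<odot>\<^bsub>B\<^esub> \<zero>\<^bsub>B\<^esub> = \<zero>\<^bsub>B\<^esub>" for a using B.smult_r_null by simp
  have "submodule I \<CC> A"
    by (rule A.submoduleI) (auto simp: I_def z mi ad sm zs)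
  then show I: "algebra_ideal I A"
    by (auto simp: algebra_ideal_def I_def mu zl zr c)
  show eq: "h x = h y" if "x \<in> carrier A" "y \<in> carrier A" "x \<ominus>\<^bsub>A\<^esub> y \<in> I" for x y
    using that re[of "h x" "h y"] c by (simp add: I_def su)
  show "delta_novikov \<delta> (quotient_algebra A I)"
    unfolding A.delta_novikov_quotient_iff[OF I]
  proof (intro ballI conjI)
    fix x y z assume "x \<in> carrier A" "y \<in> carrier A" "z \<in> carrier A"
    then show "\<delta> \<odot>\<^bsub>A\<^esub> ((x \<otimes>\<^bsub>A\<^esub> y) \<otimes>\<^bsub>A\<^esub> z) \<ominus>\<^bsub>A\<^esub> x \<otimes>\<^bsub>A\<^esub> (y \<otimes>\<^bsub>A\<^esub> z) \<ominus>\<^bsub>A\<^esub>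
      (\<delta> \<odot>\<^bsub>A\<^esub> ((y \<otimes>\<^bsub>A\<^esub> x) \<otimes>\<^bsub>A\<^esub> z) \<ominus>\<^bsub>A\<^esub> y \<otimes>\<^bsub>A\<^esub> (x \<otimes>\<^bsub>A\<^esub> z)) \<in> I"
      "(x \<otimes>\<^bsub>A\<^esub> y) \<otimes>\<^bsub>A\<^esub> z \<ominus>\<^bsub>A\<^esub> (x \<otimes>\<^bsub>A\<^esub> z) \<otimes>\<^bsub>A\<^esub> y \<in> I"
      using B.delta_left_symmetric[of "h x" "h y" "h z"] B.right_commutative[of "h x" "h y" "h z"]
      by (simp_all add: I_def su sm mu c re)
  qed
qed

definition free_generator :: "complex \<Rightarrow> 'x set \<Rightarrow> 'x \<Rightarrow> ('x magma \<Rightarrow>\<^sub>0 complex) set"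
  where "free_generator \<delta> V v =
    delta_novikov_ideal \<delta> V +>\<^bsub>free_nonassoc_algebra V\<^esub> Poly_Mapping.single (Gen v) 1"

theorem free_delta_novikov_universal:
  fixes B :: "(complex, 'b) module"
  assumes B: "delta_novikov \<delta> B" and f: "f \<in> V \<rightarrow> carrier B"
  shows "\<exists>h\<in>algebra_hom (free_delta_novikov \<delta> V) B. \<forall>v\<in>V. h (free_generator \<delta> V v) = f v"
    and "\<lbrakk>g \<in> algebra_hom (free_delta_novikov \<delta> V) B; h \<in> algebra_hom (free_delta_novikov \<delta> V) B;
      \<And>v. v \<in> V \<Longrightarrow> g (free_generator \<delta> V v) = h (free_generator \<delta> V v);
      x \<in> carrier (free_delta_novikov \<delta> V)\<rbrakk> \<Longrightarrow> g x = h x"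
proof -
  interpret F: complex_algebra "free_nonassoc_algebra V" by (rule complex_algebra_free_nonassoc_algebra)
  interpret B: delta_novikov \<delta> B by (rule B)
  note id = algebra_ideal_delta_novikov_ideal[of \<delta> V]
  note q = F.quotient_add[OF id] F.quotient_mult[OF id] F.quotient_smult[OF id] F.quotient_carrier[OF id]
  let ?e = "B.eval_magma_poly f"
  let ?N = "delta_novikov_ideal \<delta> V"
  let ?q = "\<lambda>x. ?N +>\<^bsub>free_nonassoc_algebra V\<^esub> x"
  note e = B.eval_magma_poly_hom[OF f]
  note ker = hom_kernel[OF complex_algebra_free_nonassoc_algebra B e]
  have sub: "?N \<subseteq> {x \<in> carrier (free_nonassoc_algebra V). ?e x = \<zero>\<^bsub>B\<^esub>}"
    unfolding delta_novikov_ideal_def using ker(1,2) by blast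
  define h where "h = (\<lambda>K. ?e (SOME y. y \<in> carrier (free_nonassoc_algebra V) \<and> ?q y = K))"
  have h: "h (?q x) = ?e x" if x: "x \<in> carrier (free_nonassoc_algebra V)" for x
  proof -
    define y where "y = (SOME y. y \<in> carrier (free_nonassoc_algebra V) \<and> ?q y = ?q x)"
    have y: "y \<in> carrier (free_nonassoc_algebra V) \<and> ?q y = ?q x"
      unfolding y_def by (rule someI[of _ x]) (use x in simp)
    then have "y \<ominus>\<^bsub>free_nonassoc_algebra V\<^esub> x \<in> ?N" using x F.coset_eq_iff[OF id] by blast
    then have "?e y = ?e x" using ker(3)[of y x] sub x y by blast
    then show ?thesis by (simp add: h_def y_def)
  qed
  have "h \<in> algebra_hom (free_delta_novikov \<delta> V) B"
    using e F.M.a_closed F.smult_closed F.mult_closed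
    unfolding algebra_hom_def free_delta_novikov_def
    by (auto simp: q h simp del: free_nonassoc_algebra_simps)
  moreover have "h (free_generator \<delta> V v) = f v" if "v \<in> V" for v
    using that f B.smult_one by (auto simp: free_generator_def h B.eval_magma_poly_single[OF f])
  ultimately show "\<exists>h\<in>algebra_hom (free_delta_novikov \<delta> V) B. \<forall>v\<in>V. h (free_generator \<delta> V v) = f v"
    by blast
  fix g h x assume g: "g \<in> algebra_hom (free_delta_novikov \<delta> V) B" and h: "h \<in> algebra_hom (free_delta_novikov \<delta> V) B"
    and gh: "\<And>v. v \<in> V \<Longrightarrow> g (free_generator \<delta> V v) = h (free_generator \<delta> V v)"
    and x: "x \<in> carrier (free_delta_novikov \<delta> V)"
  have gen: "g (?q (Poly_Mapping.single m 1)) = h (?q (Poly_Mapping.single m 1))" if "set_magma m \<subseteq> V" for m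
    using that
  proof (induction m)
    case (Gen v)
    then show ?case using gh by (simp add: free_generator_def)
  next
    case (Mul s t)
    have "?q (Poly_Mapping.single (Mul s t) 1) = ?q (Poly_Mapping.single s 1) \<otimes>\<^bsub>free_delta_novikov \<delta> V\<^esub> ?q (Poly_Mapping.single t 1)"
      using Mul by (simp add: q free_delta_novikov_def)
    moreover have "?q (Poly_Mapping.single s 1) \<in> carrier (free_delta_novikov \<delta> V)" "?q (Poly_Mapping.single t 1) \<in> carrier (free_delta_novikov \<delta> V)"
      using Mul by (auto simp: q free_delta_novikov_def)
    ultimately show ?case using g h Mul by (auto simp: algebra_hom_def)
  qed
  have "g (?q p) = h (?q p)" if "p \<in> carrier (free_nonassoc_algebra V)" for p
    using that
  proof (induction rule: free_nonassoc_algebra_induct)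
    case zero
    have zero: "?q (Poly_Mapping.map ((*) 0) 0) = 0 \<odot>\<^bsub>free_delta_novikov \<delta> V\<^esub> ?q 0"
      using F.M.zero_closed by (simp add: q free_delta_novikov_def)
    have map0: "Poly_Mapping.map ((*) 0) 0 = (0 :: 'a magma \<Rightarrow>\<^sub>0 complex)" by (simp add: poly_mapping_eqI)
    have q0: "?q 0 \<in> carrier (free_delta_novikov \<delta> V)" 
      using F.M.zero_closed by (auto simp: q free_delta_novikov_def)
    have "k (?q 0) = \<zero>\<^bsub>B\<^esub>" if k: "k \<in> algebra_hom (free_delta_novikov \<delta> V) B" for k
    proof -
      have "k (?q 0) = k (0 \<odot>\<^bsub>free_delta_novikov \<delta> V\<^esub> ?q 0)"
        using zero map0 by simp
      also have "\<dots> = 0 \<odot>\<^bsub>B\<^esub> k (?q 0)"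
        using k q0 unfolding algebra_hom_def by blast
      also have "\<dots> = \<zero>\<^bsub>B\<^esub>"
        using B.smult_l_null[of "k (?q 0)"] k q0 by (auto simp: algebra_hom_def)
      finally show ?thesis .
    qed
    from this[OF g] this[OF h] show ?case by simp
  next
    case (single c m)
    have "?q (Poly_Mapping.single m c) = c \<odot>\<^bsub>free_delta_novikov \<delta> V\<^esub> ?q (Poly_Mapping.single m 1)"
      using single by (simp add: q free_delta_novikov_def)
    moreover have "?q (Poly_Mapping.single m 1) \<in> carrier (free_delta_novikov \<delta> V)"
      using single by (auto simp: q free_delta_novikov_def)
    ultimately show ?case using g h gen single by (auto simp: algebra_hom_def)
  next
    case (add p p')
    have "?q (p + p') = ?q p \<oplus>\<^bsub>free_delta_novikov \<delta> V\<^esub> ?q p'"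
      using add by (simp add: q free_delta_novikov_def)
    moreover have "?q p \<in> carrier (free_delta_novikov \<delta> V)" "?q p' \<in> carrier (free_delta_novikov \<delta> V)"
      using add by (auto simp: q free_delta_novikov_def)
    ultimately show ?case using g h add by (auto simp: algebra_hom_def)
  qed
  then show "g x = h x" using x by (auto simp: q free_delta_novikov_def)
qed


section \<open>The Nielsen--Schreier property\<close>

text \<open>
  The generators of a free algebra are linearly independent, so the cardinality of a free generating
  set of \<open>A\<close> never exceeds that of the carrier of \<open>A\<close>; hence taking the index set \<open>Y\<close> in the type
  of elements of \<open>A\<close> is no restriction.
\<close>

definition is_free_delta_novikov :: "complex \<Rightarrow> (complex, 'a) module \<Rightarrow> bool"
  where "is_free_delta_novikov \<delta> A \<longleftrightarrow>
    (\<exists>Y :: 'a set. algebra_isomorphic A (free_delta_novikov \<delta> Y))"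

text \<open>
  HOL cannot quantify over types inside a formula, so the property is relative to the type \<open>'x\<close>
  from which the generators of the ambient free algebra are taken; \<open>'x = nat\<close> covers exactly the
  free algebras of countable rank.  Failure for a single type \<open>'x\<close> refutes the unrestricted property.
\<close>

definition delta_novikov_nielsen_schreier :: "'x itself \<Rightarrow> complex \<Rightarrow> bool"
  where "delta_novikov_nielsen_schreier _ \<delta> \<longleftrightarrow>
    (\<forall>(V :: 'x set) S. is_subalgebra S (free_delta_novikov \<delta> V) \<longrightarrow>
      is_free_delta_novikov \<delta> ((free_delta_novikov \<delta> V)\<lparr>carrier := S\<rparr>))"

end

theory Submission
  imports Defs
begin

text \<open>
  Both defining identities have degree three, so they impose nothing on products of two generators.
  The idea, the same for every \<open>\<delta>\<close>, is to find a subalgebra of a free algebra in which an identity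
  shows up as a relation between products of only two generators.

  A free algebra has no quadratic relations between elements that are independent modulo products:
  if \<open>\<phi>\<close> and \<open>\<psi>\<close> are linear forms that vanish on all products, then the bilinear form
  \<open>\<phi> u * \<psi> v\<close> is \<open>\<tau> (u v)\<close> for a linear form \<open>\<tau>\<close>.  The form \<open>\<tau>\<close> is a coordinate of a homomorphism
  into a three-dimensional algebra in which every product of three elements vanishes
  (\<open>free_product_form\<close>).

  On the other hand, let \<open>F\<close> be free on \<open>x\<close>, \<open>z\<close>, \<open>y\<close> and write \<open>p'\<close> for \<open>p y\<close>.  Right commutativity
  gives \<open>(p q)' = p' q\<close>, so the other identity, applied to \<open>x\<close>, \<open>z\<close>, \<open>y\<close>, becomes
  \<open>\<delta> (x' z) + z x' = \<delta> (z' x) + x z'\<close>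
  (\<open>quadratic_relation\<close>).  This is of degree three in \<open>F\<close>, but it is a quadratic relation in the
  subalgebra \<open>S\<close> of all elements without a linear term in \<open>y\<close>.  There \<open>x\<close>, \<open>z\<close>, \<open>x'\<close>, \<open>z'\<close> are
  independent modulo products, precisely because \<open>y\<close> is missing from \<open>S\<close>.  With \<open>\<phi>\<close> the coefficient of
  \<open>x\<close> and \<open>\<psi>\<close> the coefficient of \<open>z y\<close>, applying \<open>\<tau>\<close> to the relation gives \<open>0 = 1\<close>.  Hence \<open>S\<close> is not
  free.
\<close>

section \<open>Algebras in which products of three elements vanish\<close>

lemma (in complex_algebra) delta_novikov_if_triple_products_zero:
  assumes "\<And>x y z. \<lbrakk>x \<in> carrier A; y \<in> carrier A; z \<in> carrier A\<rbrakk> \<Longrightarrow> (x \<otimes> y) \<otimes> z = \<zero>"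
    and "\<And>x y z. \<lbrakk>x \<in> carrier A; y \<in> carrier A; z \<in> carrier A\<rbrakk> \<Longrightarrow> x \<otimes> (y \<otimes> z) = \<zero>"
  shows "delta_novikov \<delta> A"
  by unfold_locales (simp_all add: assms)

text \<open>
  Homomorphisms into this algebra are the linear forms that vanish on products.
\<close>

definition null_algebra :: "(complex, complex) module"
  where "null_algebra =
    \<lparr>carrier = UNIV, monoid.mult = (\<lambda>_ _. 0), one = 0, zero = 0, add = (+), module.smult = (*)\<rparr>"

lemma null_algebra_simps [simp]:
  "carrier null_algebra = UNIV"
  "a \<otimes>\<^bsub>null_algebra\<^esub> b = 0"
  "\<zero>\<^bsub>null_algebra\<^esub> = 0"
  "a \<oplus>\<^bsub>null_algebra\<^esub> b = a + b"
  "c \<odot>\<^bsub>null_algebra\<^esub> a = c * a"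
  by (simp_all add: null_algebra_def)

lemma delta_novikov_null_algebra: "delta_novikov \<delta> null_algebra"
proof -
  have "abelian_group null_algebra"
    by (rule abelian_groupI) (auto simp: algebra_simps intro: exI[of _ "- x" for x])
  then interpret complex_algebra null_algebra
    by (rule complex_algebraI) (simp_all add: algebra_simps)
  show ?thesis
    by (rule delta_novikov_if_triple_products_zero) simp_all
qed

text \<open>
  The quotient by all products of three elements of the free nonassociative algebra on two
  generators has dimension six; only the product of the first generator with the second is kept
  here, as the third coordinate.
\<close>

definition product_form_algebra :: "(complex, complex \<times> complex \<times> complex) module"
  where "product_form_algebra =
    \<lparr>carrier = UNIV, monoid.mult = (\<lambda>(a, b, c) (a', b', c'). (0, 0, a * b')), one = (0, 0, 0),
     zero = (0, 0, 0), add = (\<lambda>(a, b, c) (a', b', c'). (a + a', b + b', c + c')),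
     module.smult = (\<lambda>k (a, b, c). (k * a, k * b, k * c))\<rparr>"

lemma product_form_algebra_simps [simp]:
  "carrier product_form_algebra = UNIV"
  "(a, b, c) \<otimes>\<^bsub>product_form_algebra\<^esub> (a', b', c') = (0, 0, a * b')"
  "\<zero>\<^bsub>product_form_algebra\<^esub> = (0, 0, 0)"
  "(a, b, c) \<oplus>\<^bsub>product_form_algebra\<^esub> (a', b', c') = (a + a', b + b', c + c')"
  "k \<odot>\<^bsub>product_form_algebra\<^esub> (a, b, c) = (k * a, k * b, k * c)"
  by (simp_all add: product_form_algebra_def)

lemma delta_novikov_product_form_algebra: "delta_novikov \<delta> product_form_algebra"
proof -
  have "abelian_group product_form_algebra"
  proof (rule abelian_groupI)
    fix t :: "complex \<times> complex \<times> complex"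
    obtain a b c where "t = (a, b, c)" by (cases t)
    then show "\<exists>s\<in>carrier product_form_algebra.
        s \<oplus>\<^bsub>product_form_algebra\<^esub> t = \<zero>\<^bsub>product_form_algebra\<^esub>"
      by (intro bexI[of _ "(- a, - b, - c)"]) simp_all
  qed (auto simp: algebra_simps)
  then interpret complex_algebra product_form_algebra
    by (rule complex_algebraI) (auto simp: algebra_simps)
  show ?thesis
    by (rule delta_novikov_if_triple_products_zero) auto
qed

lemma product_form_algebra_hom_iff:
  "h \<in> algebra_hom A product_form_algebra \<longleftrightarrow>
    (\<lambda>u. fst (h u)) \<in> algebra_hom A null_algebra \<and>
    (\<lambda>u. fst (snd (h u))) \<in> algebra_hom A null_algebra \<and>
    (\<forall>u\<in>carrier A. \<forall>v\<in>carrier A. snd (snd (h (u \<oplus>\<^bsub>A\<^esub> v))) = snd (snd (h u)) + snd (snd (h v))) \<and>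
    (\<forall>c. \<forall>u\<in>carrier A. snd (snd (h (c \<odot>\<^bsub>A\<^esub> u))) = c * snd (snd (h u))) \<and>
    (\<forall>u\<in>carrier A. \<forall>v\<in>carrier A. snd (snd (h (u \<otimes>\<^bsub>A\<^esub> v))) = fst (h u) * fst (snd (h v)))"
  (is "_ \<longleftrightarrow> ?R")
proof -
  have "s \<otimes>\<^bsub>product_form_algebra\<^esub> t = (0, 0, fst s * fst (snd t))"
    "s \<oplus>\<^bsub>product_form_algebra\<^esub> t = (fst s + fst t, fst (snd s) + fst (snd t), snd (snd s) + snd (snd t))"
    "k \<odot>\<^bsub>product_form_algebra\<^esub> t = (k * fst t, k * fst (snd t), k * snd (snd t))" for s t k
    by (cases s; cases t; simp)+
  then show ?thesis
    by (auto simp: algebra_hom_def prod_eq_iff)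
qed

section \<open>Free algebras have no quadratic relations\<close>

lemma free_generator_carrier: "v \<in> V \<Longrightarrow> free_generator \<delta> V v \<in> carrier (free_delta_novikov \<delta> V)"
proof -
  interpret F: complex_algebra "free_nonassoc_algebra V" by (rule complex_algebra_free_nonassoc_algebra)
  assume "v \<in> V"
  then show ?thesis
    unfolding free_delta_novikov_def free_generator_def
      F.quotient_carrier[OF algebra_ideal_delta_novikov_ideal]
    by (intro imageI single_carrier) simp
qed

lemma algebra_hom_inv:
  assumes A: "complex_algebra A"
    and h: "h \<in> algebra_hom A B" "bij_betw h (carrier A) (carrier B)"
  shows "inv_into (carrier A) h \<in> algebra_hom B A"
proof -
  interpret A: complex_algebra A by (rule A)
  let ?k = "inv_into (carrier A) h"
  have k: "?k b \<in> carrier A" "h (?k b) = b" if "b \<in> carrier B" for b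
    using h(2) that by (auto simp: bij_betw_def inv_into_into f_inv_into_f)
  have hk: "?k (h a) = a" if "a \<in> carrier A" for a
    using h(2) that by (simp add: bij_betw_def)
  show ?thesis
    unfolding algebra_hom_def
  proof (intro CollectI conjI ballI allI Pi_I)
    fix u v c assume uv: "u \<in> carrier B" "v \<in> carrier B"
    note c = k(1)[OF uv(1)] k(1)[OF uv(2)]
    show "?k (u \<oplus>\<^bsub>B\<^esub> v) = ?k u \<oplus>\<^bsub>A\<^esub> ?k v"
      using hk[of "?k u \<oplus>\<^bsub>A\<^esub> ?k v"] h(1) c k(2) uv by (simp add: algebra_hom_def)
    show "?k (u \<otimes>\<^bsub>B\<^esub> v) = ?k u \<otimes>\<^bsub>A\<^esub> ?k v"
      using hk[of "?k u \<otimes>\<^bsub>A\<^esub> ?k v"] h(1) c k(2) uv by (simp add: algebra_hom_def)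
  next
    fix u c assume u: "u \<in> carrier B"
    show "?k (c \<odot>\<^bsub>B\<^esub> u) = c \<odot>\<^bsub>A\<^esub> ?k u"
      using hk[of "c \<odot>\<^bsub>A\<^esub> ?k u"] h(1) k[OF u] by (simp add: algebra_hom_def)
  qed (use k in blast)
qed

lemma algebra_hom_comp:
  "\<lbrakk>g \<in> algebra_hom A B; h \<in> algebra_hom B C\<rbrakk> \<Longrightarrow> (\<lambda>u. h (g u)) \<in> algebra_hom A C"
  by (auto simp: algebra_hom_def Pi_iff)

text \<open>
  Sending each generator to its values under \<open>\<phi>\<close> and \<open>\<psi>\<close>, with third coordinate zero, extends to a
  homomorphism.  Its first two coordinates vanish on products and agree with \<open>\<phi>\<close> and \<open>\<psi>\<close> on
  generators, so they are \<open>\<phi>\<close> and \<open>\<psi>\<close>; its third coordinate is the required form.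
\<close>

lemma free_product_form:
  assumes A: "complex_algebra A" and free: "is_free_delta_novikov \<delta> A"
    and \<phi>: "\<phi> \<in> algebra_hom A null_algebra" and \<psi>: "\<psi> \<in> algebra_hom A null_algebra"
  obtains \<tau> where
    "\<And>u v. \<lbrakk>u \<in> carrier A; v \<in> carrier A\<rbrakk> \<Longrightarrow> \<tau> (u \<oplus>\<^bsub>A\<^esub> v) = \<tau> u + \<tau> v"
    "\<And>c u. u \<in> carrier A \<Longrightarrow> \<tau> (c \<odot>\<^bsub>A\<^esub> u) = c * \<tau> u"
    "\<And>u v. \<lbrakk>u \<in> carrier A; v \<in> carrier A\<rbrakk> \<Longrightarrow> \<tau> (u \<otimes>\<^bsub>A\<^esub> v) = \<phi> u * \<psi> v"
proof -
  obtain Y :: "'a set" and h where h: "h \<in> algebra_hom A (free_delta_novikov \<delta> Y)"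
    and bij: "bij_betw h (carrier A) (carrier (free_delta_novikov \<delta> Y))"
    using free by (auto simp: is_free_delta_novikov_def algebra_isomorphic_def)
  let ?F = "free_delta_novikov \<delta> Y"
  let ?k = "inv_into (carrier A) h"
  have k: "?k \<in> algebra_hom ?F A"
    by (rule algebra_hom_inv[OF A h bij])
  obtain g where g: "g \<in> algebra_hom ?F product_form_algebra"
    and gen: "\<forall>y\<in>Y. g (free_generator \<delta> Y y) =
      (\<phi> (?k (free_generator \<delta> Y y)), \<psi> (?k (free_generator \<delta> Y y)), 0)"
    using free_delta_novikov_universal(1)[OF delta_novikov_product_form_algebra,
        of "\<lambda>y. (\<phi> (?k (free_generator \<delta> Y y)), \<psi> (?k (free_generator \<delta> Y y)), 0)" Y] by auto
  have gh: "(\<lambda>u. g (h u)) \<in> algebra_hom A product_form_algebra"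
    by (rule algebra_hom_comp[OF h g])
  have hA: "h u \<in> carrier ?F" "?k (h u) = u" if "u \<in> carrier A" for u
    using bij that by (auto simp: bij_betw_def)
  have "fst (g w) = \<phi> (?k w)" if "w \<in> carrier ?F" for w
    by (rule free_delta_novikov_universal(2)[OF delta_novikov_null_algebra,
          where f = "\<lambda>_. 0" and V = Y and \<delta> = \<delta> and g = "\<lambda>w. fst (g w)" and h = "\<lambda>w. \<phi> (?k w)"])
      (use g gen that algebra_hom_comp[OF k \<phi>] in \<open>auto simp: product_form_algebra_hom_iff\<close>)
  then have fst: "fst (g (h u)) = \<phi> u" if "u \<in> carrier A" for u
    using hA that by simp
  have "fst (snd (g w)) = \<psi> (?k w)" if "w \<in> carrier ?F" for w
    by (rule free_delta_novikov_universal(2)[OF delta_novikov_null_algebra,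
          where f = "\<lambda>_. 0" and V = Y and \<delta> = \<delta> and g = "\<lambda>w. fst (snd (g w))" and h = "\<lambda>w. \<psi> (?k w)"])
      (use g gen that algebra_hom_comp[OF k \<psi>] in \<open>auto simp: product_form_algebra_hom_iff\<close>)
  then have snd: "fst (snd (g (h u))) = \<psi> u" if "u \<in> carrier A" for u
    using hA that by simp
  show thesis
    by (rule that[of "\<lambda>u. snd (snd (g (h u)))"])
      (use gh fst snd in \<open>auto simp: product_form_algebra_hom_iff\<close>)
qed

section \<open>A subalgebra with a quadratic relation\<close>

text \<open>
  In each of \<open>\<delta> (x z) y\<close> and \<open>\<delta> (z x) y\<close>, right commutativity moves \<open>y\<close> inside; every term is then a
  multiple of a product of two elements of \<open>{x, z, x y, z y}\<close>.
\<close>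

lemma (in delta_novikov) quadratic_relation:
  assumes c: "x \<in> carrier A" "y \<in> carrier A" "z \<in> carrier A"
  shows "\<delta> \<odot> ((x \<otimes> y) \<otimes> z) \<oplus> z \<otimes> (x \<otimes> y) = \<delta> \<odot> ((z \<otimes> y) \<otimes> x) \<oplus> x \<otimes> (z \<otimes> y)"
proof -
  let ?a = "\<delta> \<odot> ((x \<otimes> y) \<otimes> z)" and ?b = "x \<otimes> (z \<otimes> y)"
  let ?c = "\<delta> \<odot> ((z \<otimes> y) \<otimes> x)" and ?d = "z \<otimes> (x \<otimes> y)"
  have cl: "?a \<in> carrier A" "?b \<in> carrier A" "?c \<in> carrier A" "?d \<in> carrier A"
    using c by auto
  have eq: "?a \<ominus> ?b = ?c \<ominus> ?d"
    using delta_left_symmetric[of x z y] right_commutative[of x z y] right_commutative[of z x y] c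
    by simp
  have "?a \<oplus> ?d = (?a \<ominus> ?b) \<oplus> (?b \<oplus> ?d)"
    using cl by (simp add: a_minus_def M.a_assoc M.r_neg1)
  also have "\<dots> = (?c \<ominus> ?d) \<oplus> (?b \<oplus> ?d)"
    by (simp only: eq)
  also have "\<dots> = ?c \<oplus> ?b"
    using cl by (simp add: a_minus_def M.a_assoc M.a_comm[of ?b ?d] M.r_neg1)
  finally show ?thesis .
qed

lemma complex_algebra_subalgebra:
  assumes A: "complex_algebra A" and S: "is_subalgebra S A"
  shows "complex_algebra (A\<lparr>carrier := S\<rparr>)"
proof -
  interpret A: complex_algebra A by (rule A)
  have sub: "S \<subseteq> carrier A"
    using S A.submoduleE(1) by (simp add: is_subalgebra_def)
  interpret S: module \<CC> "A\<lparr>carrier := S\<rparr>"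
    using S submodule.submodule_is_module[OF _ A.module_axioms] by (simp add: is_subalgebra_def)
  show ?thesis
    by unfold_locales
      (use S sub A.mult_add_left A.mult_add_right A.mult_smult_left A.mult_smult_right in
        \<open>auto simp: is_subalgebra_def subset_iff\<close>)
qed

theorem corollary9:
  fixes \<delta> :: complex
  shows "\<not> delta_novikov_nielsen_schreier TYPE(nat) \<delta>"
proof
  assume ns: "delta_novikov_nielsen_schreier TYPE(nat) \<delta>"
  define V :: "nat set" where "V = {0, 1, 2}"
  define F where "F = free_delta_novikov \<delta> V"
  define x where "x = free_generator \<delta> V 0"
  define z where "z = free_generator \<delta> V 1"
  define y where "y = free_generator \<delta> V 2"
  interpret F: delta_novikov \<delta> F
    unfolding F_def by (rule delta_novikov_free_delta_novikov)
  have xyz: "x \<in> carrier F" "y \<in> carrier F" "z \<in> carrier F"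
    by (auto simp: F_def x_def y_def z_def V_def intro: free_generator_carrier)
  obtain \<phi> where \<phi>: "\<phi> \<in> algebra_hom F null_algebra" and \<phi>_gen: "\<phi> x = 1" "\<phi> z = 0"
    using free_delta_novikov_universal(1)[OF delta_novikov_null_algebra,
        of "\<lambda>v. if v = 0 then 1 else 0" V]
    by (auto simp: F_def x_def z_def V_def)
  \<comment> \<open>The coordinates of \<open>g\<close> are the coefficients of \<open>z\<close>, of \<open>y\<close> and of \<open>z y\<close>.\<close>
  obtain g where g: "g \<in> algebra_hom F product_form_algebra"
    and g_gen: "g x = (0, 0, 0)" "g z = (1, 0, 0)" "g y = (0, 1, 0)"
    using free_delta_novikov_universal(1)[OF delta_novikov_product_form_algebra,
        of "\<lambda>v. if v = 0 then (0, 0, 0) else if v = 1 then (1, 0, 0) else (0, 1, 0)" V]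
    by (auto simp: F_def x_def y_def z_def V_def)
  note g_coord = g[unfolded product_form_algebra_hom_iff]
  define S where "S = {u \<in> carrier F. fst (snd (g u)) = 0}"
  have "algebra_ideal {u \<in> carrier F. fst (snd (g u)) = \<zero>\<^bsub>null_algebra\<^esub>} F"
    by (rule hom_kernel(1)[OF F.complex_algebra_axioms delta_novikov_null_algebra])
      (use g_coord in blast)
  then have ideal: "algebra_ideal S F" by (simp add: S_def)
  then have sub: "is_subalgebra S F"
    by (auto simp: algebra_ideal_def is_subalgebra_def S_def)
  let ?S = "F\<lparr>carrier := S\<rparr>"
  have "complex_algebra ?S"
    by (rule complex_algebra_subalgebra[OF F.complex_algebra_axioms sub])
  moreover have "is_free_delta_novikov \<delta> ?S"
    using ns sub unfolding delta_novikov_nielsen_schreier_def F_def by blast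
  moreover have "\<phi> \<in> algebra_hom ?S null_algebra"
    using \<phi> by (auto simp: algebra_hom_def S_def)
  \<comment> \<open>The coefficient of \<open>z y\<close> in a product is the coefficient of \<open>z\<close> in the first factor times that
    of \<open>y\<close> in the second, and the latter vanishes on \<open>S\<close>.\<close>
  moreover have "(\<lambda>u. snd (snd (g u))) \<in> algebra_hom ?S null_algebra"
    using g_coord by (simp add: algebra_hom_def S_def)
  ultimately obtain \<tau> where
      \<tau>_add: "\<And>u v. \<lbrakk>u \<in> S; v \<in> S\<rbrakk> \<Longrightarrow> \<tau> (u \<oplus>\<^bsub>F\<^esub> v) = \<tau> u + \<tau> v"
    and \<tau>_smult: "\<And>c u. u \<in> S \<Longrightarrow> \<tau> (c \<odot>\<^bsub>F\<^esub> u) = c * \<tau> u"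
    and \<tau>_mult: "\<And>u v. \<lbrakk>u \<in> S; v \<in> S\<rbrakk> \<Longrightarrow> \<tau> (u \<otimes>\<^bsub>F\<^esub> v) = \<phi> u * snd (snd (g v))"
    by (rule free_product_form) auto
  have mult: "u \<otimes>\<^bsub>F\<^esub> v \<in> S" if "u \<in> carrier F" "v \<in> carrier F" for u v
    using g_coord that by (auto simp: S_def algebra_hom_def)
  have smult: "c \<odot>\<^bsub>F\<^esub> u \<in> S" if "u \<in> S" for c u
    using F.ideal_smult[OF ideal that] .
  have xzS: "x \<in> S" "z \<in> S"
    using xyz g_gen by (auto simp: S_def)
  have \<phi>_mult: "\<phi> (u \<otimes>\<^bsub>F\<^esub> v) = 0" if "u \<in> carrier F" "v \<in> carrier F" for u v
    using \<phi> that by (auto simp: algebra_hom_def)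
  have zy: "snd (snd (g (x \<otimes>\<^bsub>F\<^esub> y))) = 0" "snd (snd (g (z \<otimes>\<^bsub>F\<^esub> y))) = 1"
    using g_coord xyz g_gen by auto
  have "\<tau> (\<delta> \<odot>\<^bsub>F\<^esub> ((x \<otimes>\<^bsub>F\<^esub> y) \<otimes>\<^bsub>F\<^esub> z) \<oplus>\<^bsub>F\<^esub> z \<otimes>\<^bsub>F\<^esub> (x \<otimes>\<^bsub>F\<^esub> y)) = 0"
    using xyz xzS \<phi>_gen zy by (simp add: \<tau>_add \<tau>_smult \<tau>_mult mult smult \<phi>_mult)
  moreover have "\<tau> (\<delta> \<odot>\<^bsub>F\<^esub> ((z \<otimes>\<^bsub>F\<^esub> y) \<otimes>\<^bsub>F\<^esub> x) \<oplus>\<^bsub>F\<^esub> x \<otimes>\<^bsub>F\<^esub> (z \<otimes>\<^bsub>F\<^esub> y)) = 1"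
    using xyz xzS \<phi>_gen zy by (simp add: \<tau>_add \<tau>_smult \<tau>_mult mult smult \<phi>_mult)
  ultimately show False
    using F.quadratic_relation[OF xyz] by simp
qed

end
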